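(* Let $\beta>0$, let $X,Y$ be $\beta$-homogeneous $F$-spaces and let $\varphi:X^{2}\to[0,\infty)$ be a function such that there exists an $L<1$ with $$\varphi\left(\frac{x}{2},\frac{y}{2}\right)\le\frac{L}{4^{\beta}}\varphi(x,y)\le\frac{L}{2^{\beta}}\varphi(x,y)$$ for all $x,y\in X$. Let $f:X^{2}\to Y$ be a mapping satisfying $$\|f(x+y,z+w)+f(x-y,z-w)-2f(x,z)-2f(x,w)\|\le \varphi(x,y)\,\varphi(z,w)$$ for all $x,y,z,w\in X$ and $f(x,0)=f(0,z)=0$ for all $x,z\in X$. Then there exists a unique additive-quadratic mapping $F:X^{2}\to Y$ such that $$\|f(x,z)-F(x,z)\|\le\min\left\{\frac{L}{2^{\beta}(1-L)}\varphi(x,x)\varphi(z,0),\ \frac{L}{4^{\beta}(1-L)}\varphi(x,0)\varphi(z,z)\right\}$$ for all $x,z\in X$.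
   Context: An $F$-norm on a (complex) linear space $X$ is a function $\|\cdot\|:X\to[0,\infty)$ such that: (1) $\|x\|=0$ iff $x=0$; (2) $\|\lambda x\|=\|x\|$ whenever $|\lambda|=1$; (3) $\|x+y\|\le\|x\|+\|y\|$; (4) $\|\lambda_n x\|\to0$ whenever $\lambda_n\to0$; (5) $\|\lambda x_n\|\to0$ whenever $x_n\to0$; (6) $\|\lambda_n x_n\|\to0$ whenever $\lambda_n\to0$ and $x_n\to0$. An $F$-space is a linear space with an $F$-norm that is complete for the metric $\|x-y\|$. It is $\beta$-homogeneous ($\beta>0$) if $\|tx\|=|t|^{\beta}\|x\|$ for all $x\in X$ and all $t\in\mathbb{C}$. The same $\beta$ is used for $X$ and $Y$, and both $F$-norms are written $\|\cdot\|$. A mapping $F:X^2\to Y$ is called additive-quadratic if $F(x+y,z+w)+F(x-y,z-w)-2F(x,z)-2F(x,w)=0$ for all $x,y,z,w\in X$. *)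

theory Defs
  imports "HOL-Analysis.Abstract_Metric_Spaces"
begin

locale F_norm = vector_space scale
  for scale :: "complex \<Rightarrow> 'a::ab_group_add \<Rightarrow> 'a" +
  fixes fnorm :: "'a \<Rightarrow> real"
  assumes fnorm_nonneg: "0 \<le> fnorm x"
    and fnorm_eq_0_iff: "fnorm x = 0 \<longleftrightarrow> x = 0"
    and fnorm_scale_unit: "cmod c = 1 \<Longrightarrow> fnorm (scale c x) = fnorm x"
    and fnorm_triangle: "fnorm (x + y) \<le> fnorm x + fnorm y"
    and fnorm_scale_null_left:
      "a \<longlonglongrightarrow> 0 \<Longrightarrow> (\<lambda>n. fnorm (scale (a n) x)) \<longlonglongrightarrow> 0"
    and fnorm_scale_null_right:
      "(\<lambda>n. fnorm (u n)) \<longlonglongrightarrow> 0 \<Longrightarrow> (\<lambda>n. fnorm (scale c (u n))) \<longlonglongrightarrow> 0"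
    and fnorm_scale_null_both:
      "a \<longlonglongrightarrow> 0 \<Longrightarrow> (\<lambda>n. fnorm (u n)) \<longlonglongrightarrow> 0
        \<Longrightarrow> (\<lambda>n. fnorm (scale (a n) (u n))) \<longlonglongrightarrow> 0"
begin

lemma fnorm_minus: "fnorm (- x) = fnorm x"
  using fnorm_scale_unit[of "-1" x] by simp

sublocale metric: Metric_space UNIV "\<lambda>x y. fnorm (x - y)"
proof
  fix x y z :: 'a
  show "0 \<le> fnorm (x - y)"
    by (rule fnorm_nonneg)
  show "fnorm (x - y) = fnorm (y - x)"
    using fnorm_minus[of "x - y"] by simp
  show "fnorm (x - y) = 0 \<longleftrightarrow> x = y"
    by (simp add: fnorm_eq_0_iff)
  show "fnorm (x - z) \<le> fnorm (x - y) + fnorm (y - z)"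
    using fnorm_triangle[of "x - y" "y - z"] by simp
qed

end

locale F_space = F_norm +
  assumes complete: "metric.mcomplete"

locale homogeneous_F_space = F_space +
  fixes \<beta> :: real
  assumes degree_pos: "0 < \<beta>"
    and fnorm_scale: "fnorm (scale t x) = cmod t powr \<beta> * fnorm x"

definition additive_quadratic ::
  "(complex \<Rightarrow> 'b \<Rightarrow> 'b) \<Rightarrow> ('a::ab_group_add \<Rightarrow> 'a \<Rightarrow> 'b::ab_group_add) \<Rightarrow> bool"
  where "additive_quadratic smul F \<longleftrightarrow>
    (\<forall>x y z w. F (x + y) (z + w) + F (x - y) (z - w)
      - smul 2 (F x z) - smul 2 (F x w) = 0)"

end

theory Submission imports Defs begin

text \<open>
  Write \<open>g m n x z = 2\<^sup>m 4\<^sup>n f (x/2\<^sup>m) (z/2\<^sup>n)\<close>.  The defect of \<open>f\<close> at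
  \<open>(x/2, x/2, z, 0)\<close> is \<open>f x z - 2 f (x/2) z\<close>, and at \<open>(x, 0, z/2, z/2)\<close> it is
  \<open>f x z - 4 f x (z/2)\<close>; hence raising \<open>m\<close> or \<open>n\<close> by one moves \<open>g m n x z\<close> by at most a
  constant times \<open>L^(m+n)\<close>.  The limit of \<open>g 0 n\<close> is the required mapping, and the geometric
  series gives the second bound.  Since \<open>g n 0\<close> and \<open>g 0 n\<close> are both asymptotic to \<open>g n n\<close>,
  \<open>g n 0\<close> has the same limit, which gives the first bound.
\<close>

section \<open>Geometric estimates and limits in F-spaces\<close>

context F_norm
begin

lemma fnorm_minus_commute: "fnorm (x - y) = fnorm (y - x)"
  by (rule metric.commute)

lemma fnorm_triangle_diff: "fnorm (x - z) \<le> fnorm (x - y) + fnorm (y - z)"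
  by (rule metric.triangle) auto

text \<open>The triangle inequality adds up the steps, and every partial sum of the geometric series
  is at most \<open>1 / (1 - L)\<close>.\<close>

lemma geometric_telescope:
  assumes step: "\<And>n. fnorm (s n - s (Suc n)) \<le> M * L ^ n"
    and L: "0 \<le> L" "L < 1" and M: "0 \<le> M"
  shows "fnorm (s 0 - s n) \<le> M / (1 - L)"
proof -
  have "fnorm (s 0 - s n) \<le> M * (\<Sum>i<n. L ^ i)"
  proof (induction n)
    case 0
    show ?case using fnorm_eq_0_iff[of 0] by simp
  next
    case (Suc n)
    show ?case
      using fnorm_triangle_diff[of "s 0" "s (Suc n)" "s n"] Suc step[of n]
      by (simp add: distrib_left)
  qed
  also have "(\<Sum>i<n. L ^ i) \<le> 1 / (1 - L)"
    using L by (simp add: sum_gp_strict divide_right_mono)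
  then have "M * (\<Sum>i<n. L ^ i) \<le> M / (1 - L)"
    using M mult_left_mono by fastforce
  finally show ?thesis .
qed

end

context F_space
begin

lemma geometric_limit:
  assumes step: "\<And>n. fnorm (s n - s (Suc n)) \<le> M * L ^ n"
    and L: "0 \<le> L" "L < 1" and M: "0 \<le> M"
  obtains l where "(\<lambda>n. fnorm (s n - l)) \<longlonglongrightarrow> 0"
proof -
  \<comment> \<open>The telescoping estimate is applied to the sequence shifted by \<open>n\<close>,
    whose initial step bound is \<open>M * L ^ n\<close>.\<close>
  have tail: "fnorm (s n - s (n + k)) \<le> M / (1 - L) * L ^ n" for n k
    using geometric_telescope[of "\<lambda>k. s (n + k)" "M * L ^ n" L k] step[of "n + _"] L M
    by (simp add: power_add mult_ac)
  have "metric.MCauchy s"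
    unfolding metric.MCauchy_def
  proof (intro conjI allI impI)
    fix e :: real
    assume "0 < e"
    have "(\<lambda>n. M / (1 - L) * L ^ n) \<longlonglongrightarrow> 0"
      using L by (intro tendsto_mult_right_zero LIMSEQ_power_zero) auto
    then have "\<forall>\<^sub>F n in sequentially. M / (1 - L) * L ^ n < e"
      using \<open>0 < e\<close> by (rule order_tendstoD)
    then obtain N where N: "\<And>n. n \<ge> N \<Longrightarrow> M / (1 - L) * L ^ n < e"
      by (auto simp: eventually_sequentially)
    have "fnorm (s n - s n') < e" if "N \<le> n" "n \<le> n'" for n n'
      using tail[of n "n' - n"] N[of n] that by simp
    then show "\<exists>N. \<forall>n n'. N \<le> n \<longrightarrow> N \<le> n' \<longrightarrow> fnorm (s n - s n') < e"
      by (metis fnorm_minus_commute nle_le)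
  qed auto
  then obtain l where "limitin metric.mtopology s l sequentially"
    using complete by (auto simp: metric.mcomplete_def)
  then have "(\<lambda>n. fnorm (s n - l)) \<longlonglongrightarrow> 0"
    by (simp add: metric.limitin_metric_dist_null)
  with that show ?thesis .
qed

end

section \<open>Additive-quadratic mappings and halving of the second argument\<close>

lemma (in F_norm) additive_quadratic_zero_right:
  assumes "additive_quadratic scale F"
  shows "F x 0 = 0"
proof -
  have "F (x + 0) (0 + 0) + F (x - 0) (0 - 0) - scale 2 (F x 0) - scale 2 (F x 0) = 0"
    using assms unfolding additive_quadratic_def by blast
  moreover have "F x 0 + F x 0 = scale 2 (F x 0)"
    using scale_left_distrib[of 1 1 "F x 0"] by simp
  ultimately have "scale 2 (F x 0) = 0"
    by simp
  then show ?thesis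
    by simp
qed

text \<open>Putting \<open>y = 0\<close> and \<open>w = z\<close> in the equation gives
  \<open>F x (2z) + F x 0 = 4 F x z\<close>, and \<open>F x 0\<close> vanishes. Uniqueness rests on
  this identity.\<close>

lemma (in F_norm) additive_quadratic_power:
  fixes scaleX :: "complex \<Rightarrow> 'c::ab_group_add \<Rightarrow> 'c"
  assumes X: "vector_space scaleX"
    and F: "additive_quadratic scale F"
  shows "F x z = scale (4 ^ n) (F x (scaleX ((1/2) ^ n) z))"
proof (induction n)
  interpret X: vector_space scaleX by (rule X)
  case 0
  show ?case by simp
next
  interpret X: vector_space scaleX by (rule X)
  case (Suc n)
  let ?u = "scaleX ((1/2) ^ Suc n) z"
  have "F (x + 0) (?u + ?u) + F (x - 0) (?u - ?u) - scale 2 (F x ?u) - scale 2 (F x ?u) = 0"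
    using F unfolding additive_quadratic_def by blast
  then have "F x (?u + ?u) = scale 4 (F x ?u)"
    using additive_quadratic_zero_right[OF F] scale_left_distrib[of 2 2 "F x ?u"]
    by (simp add: algebra_simps)
  moreover have "?u + ?u = scaleX ((1/2) ^ n) z"
    by (simp flip: X.scale_left_distrib)
  ultimately show ?case
    using Suc by (simp add: mult.commute)
qed

section \<open>Decay of the control function and of the defect under rescaling\<close>

locale stability_problem =
  X: homogeneous_F_space scaleX normX \<beta> + Y: homogeneous_F_space scaleY normY \<beta>
  for scaleX :: "complex \<Rightarrow> 'a::ab_group_add \<Rightarrow> 'a" and normX \<beta>
    and scaleY :: "complex \<Rightarrow> 'b::ab_group_add \<Rightarrow> 'b" and normY +
  fixes \<phi> :: "'a \<Rightarrow> 'a \<Rightarrow> real" and f :: "'a \<Rightarrow> 'a \<Rightarrow> 'b" and L :: real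
  assumes phi_nonneg: "0 \<le> \<phi> x y"
    and L_nonneg: "0 \<le> L" and L_less_1: "L < 1"
    and phi_half: "\<phi> (scaleX (1/2) x) (scaleX (1/2) y) \<le> L / 4 powr \<beta> * \<phi> x y"
    and defect: "normY (f (x + y) (z + w) + f (x - y) (z - w)
            - scaleY 2 (f x z) - scaleY 2 (f x w)) \<le> \<phi> x y * \<phi> z w"
    and f_zero_right: "f x 0 = 0" and f_zero_left: "f 0 z = 0"
begin

lemma two_powr_le_four_powr: "2 powr \<beta> \<le> 4 powr \<beta>"
  using X.degree_pos by (simp add: powr_mono2)

lemma phi_power:
  "\<phi> (scaleX ((1/2) ^ n) x) (scaleX ((1/2) ^ n) y) \<le> (L / 4 powr \<beta>) ^ n * \<phi> x y"
proof (induction n)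
  case 0
  show ?case by simp
next
  case (Suc n)
  have "\<phi> (scaleX ((1/2) ^ Suc n) x) (scaleX ((1/2) ^ Suc n) y)
      \<le> L / 4 powr \<beta> * \<phi> (scaleX ((1/2) ^ n) x) (scaleX ((1/2) ^ n) y)"
    using phi_half[of "scaleX ((1/2) ^ n) x" "scaleX ((1/2) ^ n) y"] by simp
  also have "\<dots> \<le> L / 4 powr \<beta> * ((L / 4 powr \<beta>) ^ n * \<phi> x y)"
    using Suc L_nonneg by (intro mult_left_mono) auto
  finally show ?case by (simp add: mult_ac)
qed

text \<open>Each halving gains \<open>L / 4 powr \<beta>\<close>, which also compensates the smaller
  factor \<open>2 powr \<beta>\<close> that belongs to the first argument of
  \<open>f\<close>.\<close>

lemma two_power_phi_power:
  "(2 powr \<beta>) ^ n * \<phi> (scaleX ((1/2) ^ n) x) (scaleX ((1/2) ^ n) y) \<le> L ^ n * \<phi> x y"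
proof -
  have "(2 powr \<beta>) ^ n * \<phi> (scaleX ((1/2) ^ n) x) (scaleX ((1/2) ^ n) y)
      \<le> (4 powr \<beta>) ^ n * ((L / 4 powr \<beta>) ^ n * \<phi> x y)"
    using two_powr_le_four_powr phi_nonneg phi_power by (intro mult_mono power_mono) auto
  then show ?thesis by (simp add: power_divide)
qed

lemma four_power_phi_power:
  "(4 powr \<beta>) ^ n * \<phi> (scaleX ((1/2) ^ n) x) (scaleX ((1/2) ^ n) y) \<le> L ^ n * \<phi> x y"
  using mult_left_mono[OF phi_power[of n x y], of "(4 powr \<beta>) ^ n"]
  by (simp add: power_divide)

lemma normY_scale_power:
  "normY (scaleY (2 ^ m * 4 ^ n) v) = (2 powr \<beta>) ^ m * (4 powr \<beta>) ^ n * normY v"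
proof -
  have "(2 ^ m) powr \<beta> = (2 powr \<beta>) ^ m" "(4 ^ n) powr \<beta> = (4 powr \<beta>) ^ n"
    by (simp_all flip: powr_realpow add: powr_powr mult.commute)
  then show ?thesis
    by (simp add: Y.fnorm_scale norm_mult norm_power powr_mult)
qed

definition g :: "nat \<Rightarrow> nat \<Rightarrow> 'a \<Rightarrow> 'a \<Rightarrow> 'b" where
  "g m n x z = scaleY (2 ^ m * 4 ^ n) (f (scaleX ((1/2) ^ m) x) (scaleX ((1/2) ^ n) z))"

lemma g_zero_zero: "g 0 0 x z = f x z"
  by (simp add: g_def)

lemma g_zero_left [simp]: "g m n 0 z = 0"
  by (simp add: g_def f_zero_left)

lemma g_zero_right [simp]: "g m n x 0 = 0"
  by (simp add: g_def f_zero_right)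

text \<open>The weight splits along the two arguments: \<open>2 ^ m\<close> is absorbed by the
  control of the first arguments \<open>x\<close>, \<open>y\<close>, and \<open>4 ^ n\<close> by
  that of the second arguments \<open>z\<close>, \<open>w\<close>.\<close>

lemma defect_g:
  "normY (g m n (x + y) (z + w) + g m n (x - y) (z - w)
      - scaleY 2 (g m n x z) - scaleY 2 (g m n x w)) \<le> L ^ (m + n) * (\<phi> x y * \<phi> z w)"
  (is "normY ?d \<le> _")
proof -
  let ?h = "\<lambda>m. scaleX ((1/2) ^ m)"
  have "?d = scaleY (2 ^ m * 4 ^ n)
      (f (?h m x + ?h m y) (?h n z + ?h n w) + f (?h m x - ?h m y) (?h n z - ?h n w)
        - scaleY 2 (f (?h m x) (?h n z)) - scaleY 2 (f (?h m x) (?h n w)))"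
    by (simp add: g_def X.scale_right_distrib X.scale_right_diff_distrib
        Y.scale_right_distrib Y.scale_right_diff_distrib mult_ac)
  then have "normY ?d \<le> (2 powr \<beta>) ^ m * (4 powr \<beta>) ^ n
      * (\<phi> (?h m x) (?h m y) * \<phi> (?h n z) (?h n w))"
    using defect by (simp add: normY_scale_power mult_left_mono)
  also have "\<dots> = ((2 powr \<beta>) ^ m * \<phi> (?h m x) (?h m y))
      * ((4 powr \<beta>) ^ n * \<phi> (?h n z) (?h n w))"
    by simp
  also have "\<dots> \<le> (L ^ m * \<phi> x y) * (L ^ n * \<phi> z w)"
    using L_nonneg phi_nonneg
    by (intro mult_mono two_power_phi_power four_power_phi_power) auto
  finally show ?thesis
    by (simp add: power_add mult_ac)
qed

lemma half_add_half: "scaleX (1/2) x + scaleX (1/2) x = x"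
  by (simp flip: X.scale_left_distrib)

lemma g_Suc_left: "g (Suc m) n x z = scaleY 2 (g m n (scaleX (1/2) x) z)"
  by (simp add: g_def mult_ac)

lemma g_Suc_right: "g m (Suc n) x z = scaleY 4 (g m n x (scaleX (1/2) z))"
  by (simp add: g_def mult_ac)

lemma g_step_left:
  "normY (g m n x z - g (Suc m) n x z) \<le> L / 2 powr \<beta> * \<phi> x x * \<phi> z 0 * L ^ (m + n)"
proof -
  \<comment> \<open>Halving yields the constant with \<open>4 powr \<beta>\<close>; it is weakened
    to the one in the first bound of the claim.\<close>
  have "L / 4 powr \<beta> \<le> L / 2 powr \<beta>"
    using L_nonneg two_powr_le_four_powr by (simp add: divide_left_mono)
  then have "\<phi> (scaleX (1/2) x) (scaleX (1/2) x) \<le> L / 2 powr \<beta> * \<phi> x x"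
    using phi_half[of x x] mult_right_mono[OF _ phi_nonneg] order_trans by blast
  then have "L ^ (m + n) * (\<phi> (scaleX (1/2) x) (scaleX (1/2) x) * \<phi> z 0)
      \<le> L ^ (m + n) * (L / 2 powr \<beta> * \<phi> x x * \<phi> z 0)"
    using L_nonneg phi_nonneg by (intro mult_left_mono mult_right_mono) auto
  then show ?thesis
    using defect_g[of m n "scaleX (1/2) x" "scaleX (1/2) x" z 0]
    by (simp add: half_add_half g_Suc_left mult_ac)
qed

lemma g_step_right:
  "normY (g m n x z - g m (Suc n) x z) \<le> L / 4 powr \<beta> * \<phi> x 0 * \<phi> z z * L ^ (m + n)"
proof -
  let ?u = "scaleX (1/2) z"
  \<comment> \<open>The term with second argument \<open>?u - ?u\<close> vanishes, and the two equal
    subtracted terms combine to \<open>g m (Suc n) x z\<close>.\<close>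
  have "g m n (x + 0) (?u + ?u) + g m n (x - 0) (?u - ?u)
      - scaleY 2 (g m n x ?u) - scaleY 2 (g m n x ?u) = g m n x z - g m (Suc n) x z"
    using Y.scale_left_distrib[of 2 2 "g m n x ?u"]
    by (simp add: half_add_half g_Suc_right algebra_simps)
  then have "normY (g m n x z - g m (Suc n) x z) \<le> L ^ (m + n) * (\<phi> x 0 * \<phi> ?u ?u)"
    using defect_g[of m n x 0 ?u ?u] by simp
  also have "\<dots> \<le> L ^ (m + n) * (\<phi> x 0 * (L / 4 powr \<beta> * \<phi> z z))"
    using phi_half L_nonneg phi_nonneg by (intro mult_left_mono) auto
  finally show ?thesis
    by (simp add: mult_ac)
qed

section \<open>The limit mapping and its two error bounds\<close>

lemma exists_limit: "\<exists>l. (\<lambda>n. normY (g 0 n x z - l)) \<longlonglongrightarrow> 0"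
proof -
  have "0 \<le> L / 4 powr \<beta> * \<phi> x 0 * \<phi> z z"
    using L_nonneg phi_nonneg by simp
  then show ?thesis
    using Y.geometric_limit[of "\<lambda>n. g 0 n x z"] g_step_right[of 0 _ x z] L_nonneg L_less_1
    by (metis add_0)
qed

text \<open>The choice is justified by \<open>exists_limit\<close>; afterwards \<open>G\<close> is
  accessed only through \<open>tendsto_G\<close>.\<close>

definition G :: "'a \<Rightarrow> 'a \<Rightarrow> 'b" where
  "G x z = (SOME l. (\<lambda>n. normY (g 0 n x z - l)) \<longlonglongrightarrow> 0)"

lemma tendsto_G: "(\<lambda>n. normY (g 0 n x z - G x z)) \<longlonglongrightarrow> 0"
  unfolding G_def using exists_limit by (rule someI_ex)

lemma tendsto_power_L: "(\<lambda>n. c * L ^ n) \<longlonglongrightarrow> 0"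
  using L_nonneg L_less_1 by (intro tendsto_mult_right_zero LIMSEQ_power_zero) auto

text \<open>The defect of \<open>g 0 n\<close> is of order \<open>L ^ n\<close>, and the defect of a
  mapping depends continuously on its four values.\<close>

lemma additive_quadratic_G: "additive_quadratic scaleY G"
  unfolding additive_quadratic_def
proof (intro allI)
  fix x y z w :: 'a
  let ?D = "\<lambda>H. H (x + y) (z + w) + H (x - y) (z - w) - scaleY 2 (H x z) - scaleY 2 (H x w)"
  let ?e = "\<lambda>n x z. normY (g 0 n x z - G x z)"
  let ?b = "\<lambda>n. ?e n (x + y) (z + w) + ?e n (x - y) (z - w)
      + 2 powr \<beta> * ?e n x z + 2 powr \<beta> * ?e n x w + \<phi> x y * \<phi> z w * L ^ n"
  have "normY (?D G) \<le> ?b n" for n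
  proof -
    let ?r = "\<lambda>x z. g 0 n x z - G x z"
    have sub: "normY (a - b) \<le> normY a + normY b" for a b
      using Y.fnorm_triangle[of a "- b"] by (simp add: Y.fnorm_minus)
    \<comment> \<open>The defect is linear in the mapping, so the errors \<open>?r\<close> at the
      four points separate from the defect of \<open>g 0 n\<close>.\<close>
    have "?D G = ?D (g 0 n) - (?r (x + y) (z + w) + ?r (x - y) (z - w)
        - scaleY 2 (?r x z) - scaleY 2 (?r x w))"
      by (simp add: Y.scale_right_diff_distrib algebra_simps)
    then have "normY (?D G) \<le> normY (?D (g 0 n)) + (?e n (x + y) (z + w) + ?e n (x - y) (z - w)
        + normY (scaleY 2 (?r x z)) + normY (scaleY 2 (?r x w)))"
      using sub[of "?D (g 0 n)"] sub[of "_ - _" "scaleY 2 (?r x w)"]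
        sub[of "_ + _" "scaleY 2 (?r x z)"] Y.fnorm_triangle[of "?r (x + y) (z + w)"]
      by (smt (verit))
    then show ?thesis
      using defect_g[of 0 n x y z w] by (simp add: Y.fnorm_scale mult_ac)
  qed
  moreover have "?b \<longlonglongrightarrow> 0 + 0 + 2 powr \<beta> * 0 + 2 powr \<beta> * 0 + 0"
    by (intro tendsto_intros tendsto_G tendsto_power_L)
  ultimately have "normY (?D G) \<le> 0"
    by (intro LIMSEQ_le_const[of ?b]) auto
  then show "?D G = 0"
    using Y.fnorm_nonneg Y.fnorm_eq_0_iff by (metis order_antisym)
qed

text \<open>Telescoping in the first index with the second fixed at \<open>n\<close> leaves the
  factor \<open>L ^ n\<close>. The case \<open>n = 0\<close> compares \<open>f\<close> with
  \<open>g k 0\<close>; for large \<open>n\<close> the bound makes \<open>g 0 n\<close> and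
  \<open>g n n\<close> close.\<close>

lemma g_left_bound:
  "normY (g 0 n x z - g k n x z) \<le> L / (2 powr \<beta> * (1 - L)) * \<phi> x x * \<phi> z 0 * L ^ n"
  using Y.geometric_telescope[of "\<lambda>m. g m n x z" "L / 2 powr \<beta> * \<phi> x x * \<phi> z 0 * L ^ n" L k]
    g_step_left[of _ n x z] L_nonneg L_less_1 phi_nonneg
  by (simp add: power_add mult_ac)

lemma g_right_bound:
  "normY (g m 0 x z - g m k x z) \<le> L / (4 powr \<beta> * (1 - L)) * \<phi> x 0 * \<phi> z z * L ^ m"
  using Y.geometric_telescope[of "\<lambda>n. g m n x z" "L / 4 powr \<beta> * \<phi> x 0 * \<phi> z z * L ^ m" L k]
    g_step_right[of m _ x z] L_nonneg L_less_1 phi_nonneg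
  by (simp add: power_add mult_ac)

lemma f_G_bound_right:
  "normY (f x z - G x z) \<le> L / (4 powr \<beta> * (1 - L)) * \<phi> x 0 * \<phi> z z" (is "_ \<le> ?B")
proof -
  have "normY (f x z - G x z) \<le> ?B + normY (g 0 n x z - G x z)" for n
    using Y.fnorm_triangle_diff[of "f x z" "G x z" "g 0 n x z"] g_right_bound[of 0 x z n]
    by (simp add: g_zero_zero)
  moreover have "(\<lambda>n. ?B + normY (g 0 n x z - G x z)) \<longlonglongrightarrow> ?B + 0"
    by (intro tendsto_intros tendsto_G)
  ultimately show ?thesis
    by (intro LIMSEQ_le_const[of _ ?B]) auto
qed

lemma f_G_bound_left:
  "normY (f x z - G x z) \<le> L / (2 powr \<beta> * (1 - L)) * \<phi> x x * \<phi> z 0" (is "_ \<le> ?A")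
proof -
  let ?B = "L / (4 powr \<beta> * (1 - L)) * \<phi> x 0 * \<phi> z z"
  let ?b = "\<lambda>n. ?A + ?B * L ^ n + ?A * L ^ n + normY (g 0 n x z - G x z)"
  \<comment> \<open>The path runs from \<open>f\<close> over \<open>g n 0\<close>,
    \<open>g n n\<close> and \<open>g 0 n\<close> to \<open>G\<close>; only its first leg does not
    tend to zero.\<close>
  have "normY (f x z - G x z) \<le> ?b n" for n
    using Y.fnorm_triangle_diff[of "f x z" "G x z" "g n 0 x z"]
      Y.fnorm_triangle_diff[of "g n 0 x z" "G x z" "g n n x z"]
      Y.fnorm_triangle_diff[of "g n n x z" "G x z" "g 0 n x z"]
      g_left_bound[of 0 x z n] g_right_bound[of n x z n] g_left_bound[of n x z n]
      Y.fnorm_minus_commute[of "g n n x z" "g 0 n x z"]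
    by (simp add: g_zero_zero)
  moreover have "?b \<longlonglongrightarrow> ?A + 0 + 0 + 0"
    by (intro tendsto_add tendsto_const tendsto_G tendsto_power_L)
  ultimately show ?thesis
    by (intro LIMSEQ_le_const[of ?b]) auto
qed

section \<open>Uniqueness and the final statement\<close>

text \<open>Both mappings are reproduced by \<open>n\<close> halvings of \<open>z\<close> with
  weight \<open>4 ^ n\<close>. Their distance at the halved point is controlled through
  \<open>f\<close>, and the decay of \<open>\<phi>\<close> outweighs the factor \<open>4 ^ n\<close>
  by \<open>L ^ n\<close>.\<close>

lemma additive_quadratic_unique:
  assumes H: "additive_quadratic scaleY H"
    and bound: "\<And>x z. normY (f x z - H x z) \<le> C * \<phi> x 0 * \<phi> z z"
    and K: "additive_quadratic scaleY K"
    and bound': "\<And>x z. normY (f x z - K x z) \<le> C * \<phi> x 0 * \<phi> z z"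
    and C: "0 \<le> C"
  shows "H = K"
proof (intro ext)
  fix x z
  have "normY (H x z - K x z) \<le> 2 * C * \<phi> x 0 * \<phi> z z * L ^ n" for n
  proof -
    let ?u = "scaleX ((1/2) ^ n) z"
    \<comment> \<open>The factor \<open>2 ^ 0\<close> brings the scalar into the form of
      \<open>normY_scale_power\<close>.\<close>
    have "H x z - K x z = scaleY (2 ^ 0 * 4 ^ n) (H x ?u - K x ?u)"
      using Y.additive_quadratic_power[OF X.vector_space_axioms H, of x z n]
        Y.additive_quadratic_power[OF X.vector_space_axioms K, of x z n]
      by (simp add: Y.scale_right_diff_distrib)
    then have "normY (H x z - K x z) = (4 powr \<beta>) ^ n * normY (H x ?u - K x ?u)"
      by (simp only: normY_scale_power) simp
    also have "\<dots> \<le> (4 powr \<beta>) ^ n * (2 * C * \<phi> x 0 * \<phi> ?u ?u)"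
      using Y.fnorm_triangle_diff[of "H x ?u" "K x ?u" "f x ?u"] bound[of x ?u] bound'[of x ?u]
      by (intro mult_left_mono) (simp_all add: Y.fnorm_minus_commute)
    also have "\<dots> \<le> 2 * C * \<phi> x 0 * (L ^ n * \<phi> z z)"
      using mult_left_mono[OF four_power_phi_power[of n z z], of "2 * C * \<phi> x 0"] C phi_nonneg
      by (simp add: mult_ac)
    finally show ?thesis by (simp add: mult_ac)
  qed
  then have "normY (H x z - K x z) \<le> 0"
    by (intro LIMSEQ_le_const[OF tendsto_power_L]) auto
  then have "normY (H x z - K x z) = 0"
    using Y.fnorm_nonneg by (metis order_antisym)
  then show "H x z = K x z"
    by (simp add: Y.fnorm_eq_0_iff)
qed

theorem unique_additive_quadratic:
  "\<exists>!F. additive_quadratic scaleY F \<and>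
    (\<forall>x z. normY (f x z - F x z) \<le>
      min (L / (2 powr \<beta> * (1 - L)) * \<phi> x x * \<phi> z 0)
          (L / (4 powr \<beta> * (1 - L)) * \<phi> x 0 * \<phi> z z))"
proof (rule ex1I[of _ G], goal_cases)
  case 1
  show ?case
    using additive_quadratic_G f_G_bound_left f_G_bound_right by simp
next
  case (2 F)
  then show ?case
    using additive_quadratic_unique[OF _ _ additive_quadratic_G f_G_bound_right]
      L_nonneg L_less_1 by auto
qed

end

theorem theorem5:
  fixes \<beta> L :: real
    and scaleX :: "complex \<Rightarrow> 'a::ab_group_add \<Rightarrow> 'a"
    and normX :: "'a \<Rightarrow> real"
    and scaleY :: "complex \<Rightarrow> 'b::ab_group_add \<Rightarrow> 'b"
    and normY :: "'b \<Rightarrow> real"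
    and \<phi> :: "'a \<Rightarrow> 'a \<Rightarrow> real"
    and f :: "'a \<Rightarrow> 'a \<Rightarrow> 'b"
  assumes "0 < \<beta>"
    and "homogeneous_F_space scaleX normX \<beta>"
    and "homogeneous_F_space scaleY normY \<beta>"
    and "\<And>x y. 0 \<le> \<phi> x y"
    and "L < 1"
    and "\<And>x y. \<phi> (scaleX (1/2) x) (scaleX (1/2) y) \<le> L / 4 powr \<beta> * \<phi> x y"
    and "\<And>x y. L / 4 powr \<beta> * \<phi> x y \<le> L / 2 powr \<beta> * \<phi> x y"
    and "\<And>x y z w. normY (f (x + y) (z + w) + f (x - y) (z - w)
            - scaleY 2 (f x z) - scaleY 2 (f x w)) \<le> \<phi> x y * \<phi> z w"
    and "\<And>x. f x 0 = 0"
    and "\<And>z. f 0 z = 0"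
  shows "\<exists>!F. additive_quadratic scaleY F \<and>
    (\<forall>x z. normY (f x z - F x z) \<le>
      min (L / (2 powr \<beta> * (1 - L)) * \<phi> x x * \<phi> z 0)
          (L / (4 powr \<beta> * (1 - L)) * \<phi> x 0 * \<phi> z z))"
proof -
  \<comment> \<open>The hypotheses allow a negative \<open>L\<close>, but only together with \<open>\<phi> = 0\<close>, in which case \<open>L\<close>
    may be replaced by \<open>0\<close>.\<close>
  have nonneg: "0 \<le> L * \<phi> x y" for x y
  proof (rule ccontr)
    assume "\<not> 0 \<le> L * \<phi> x y"
    \<comment> \<open>Multiplication by a negative \<open>L * \<phi> x y\<close> reverses this
      inequality, against the second inequality assumed for \<open>\<phi>\<close>.\<close>
    moreover have "1 / 4 powr \<beta> < 1 / 2 powr \<beta>"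
      using \<open>0 < \<beta>\<close> by (simp add: frac_less2 powr_less_mono2)
    ultimately have "L * \<phi> x y * (1 / 2 powr \<beta>) < L * \<phi> x y * (1 / 4 powr \<beta>)"
      by (intro mult_strict_left_mono_neg) auto
    with assms(7)[of x y] show False by simp
  qed
  \<comment> \<open>For negative \<open>L\<close> both sides are zero, since \<open>nonneg\<close>
    then forces \<open>\<phi> x y = 0\<close>.\<close>
  have L: "max L 0 * \<phi> x y = L * \<phi> x y" for x y
    using nonneg[of x y] assms(4)[of x y]
    by (cases "0 \<le> L") (auto simp: zero_le_mult_iff intro: order_antisym)
  have half: "\<phi> (scaleX (1/2) x) (scaleX (1/2) y) \<le> max L 0 / 4 powr \<beta> * \<phi> x y" for x y
    using assms(6)[of x y] by (simp only: times_divide_eq_left L)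
  \<comment> \<open>The constants for \<open>L\<close> and \<open>max L 0\<close> may differ, but
    their products with \<open>\<phi>\<close> agree, so the conclusion for \<open>max L 0\<close> is
    the one for \<open>L\<close>.\<close>
  have factor: "max L 0 / (c * (1 - max L 0)) * \<phi> x y = L / (c * (1 - L)) * \<phi> x y" for c x y
    using L[of x y] by (cases "L \<ge> 0") auto
  interpret X: homogeneous_F_space scaleX normX \<beta> by (rule assms(2))
  interpret Y: homogeneous_F_space scaleY normY \<beta> by (rule assms(3))
  interpret stability_problem scaleX normX \<beta> scaleY normY \<phi> f "max L 0"
    using assms(4,5,8-10) half by unfold_locales auto
  show ?thesis
    using unique_additive_quadratic unfolding factor .
qed

end
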